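(* Consider an election under single transferable vote (STV) over a finite set of candidates, with the votes of the agents outside a given coalition fixed (each complete or partial), and let $p$ be a candidate. If the agents of the coalition can cast partial votes so that $p$ wins, then they can also cast complete votes so that $p$ wins.
   Context: A complete vote is a linear order over all candidates; a partial vote is a linear order over a strict subset of the candidates. Votes may carry positive integer weights, a vote of weight $w$ being treated as $w$ identical votes. STV with partial votes proceeds in rounds. In each round every vote counts for its highest ranked candidate that has not yet been eliminated; a vote all of whose ranked candidates have been eliminated is ignored. If some remaining candidate has a majority (more than half) of the votes not ignored in this round, or is the only candidate remaining, it wins. Otherwise a remaining candidate with the least number of votes in this round is eliminated, and the next round begins. Ties are broken in favour of the coalition: $p$ wins if there is some way of resolving the ties that arise for which $p$ is the winner. *)

theory Defs
  imports Main
begin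

text \<open>
  A vote is a linear order \<open>r\<close> given as a relation, with \<open>(c, d) \<in> r\<close> meaning that \<open>c\<close> is
  ranked at least as high as \<open>d\<close>. As \<open>linear_order_on\<close> is reflexive, the set of ranked
  candidates is \<open>Field r\<close>.
\<close>

definition complete_vote :: "'c set \<Rightarrow> 'c rel \<Rightarrow> bool" where
  "complete_vote C r \<longleftrightarrow> linear_order_on C r"

text \<open>The empty ranking is a partial vote; it is ignored in every round.\<close>

definition partial_vote :: "'c set \<Rightarrow> 'c rel \<Rightarrow> bool" where
  "partial_vote C r \<longleftrightarrow> (\<exists>S. S \<subset> C \<and> linear_order_on S r)"

text \<open>In the following, \<open>R\<close> is the set of candidates that have not been eliminated.\<close>

definition counts_for :: "'c set \<Rightarrow> 'c rel \<Rightarrow> 'c \<Rightarrow> bool" where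
  "counts_for R r c \<longleftrightarrow> c \<in> Field r \<inter> R \<and> (\<forall>d \<in> Field r \<inter> R. (c, d) \<in> r)"

definition ignored :: "'c set \<Rightarrow> 'c rel \<Rightarrow> bool" where
  "ignored R r \<longleftrightarrow> Field r \<inter> R = {}"

text \<open>\<open>A\<close> is the set of agents; agent \<open>i\<close> casts the vote \<open>V i\<close> with weight \<open>w i\<close>.\<close>

definition score :: "'a set \<Rightarrow> ('a \<Rightarrow> nat) \<Rightarrow> ('a \<Rightarrow> 'c rel) \<Rightarrow> 'c set \<Rightarrow> 'c \<Rightarrow> nat" where
  "score A w V R c = (\<Sum>i \<in> {i \<in> A. counts_for R (V i) c}. w i)"

definition votes_not_ignored :: "'a set \<Rightarrow> ('a \<Rightarrow> nat) \<Rightarrow> ('a \<Rightarrow> 'c rel) \<Rightarrow> 'c set \<Rightarrow> nat" where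
  "votes_not_ignored A w V R = (\<Sum>i \<in> {i \<in> A. \<not> ignored R (V i)}. w i)"

definition round_winner ::
  "'a set \<Rightarrow> ('a \<Rightarrow> nat) \<Rightarrow> ('a \<Rightarrow> 'c rel) \<Rightarrow> 'c set \<Rightarrow> 'c \<Rightarrow> bool" where
  "round_winner A w V R c \<longleftrightarrow>
     c \<in> R \<and> (2 * score A w V R c > votes_not_ignored A w V R \<or> R = {c})"

definition may_be_eliminated ::
  "'a set \<Rightarrow> ('a \<Rightarrow> nat) \<Rightarrow> ('a \<Rightarrow> 'c rel) \<Rightarrow> 'c set \<Rightarrow> 'c \<Rightarrow> bool" where
  "may_be_eliminated A w V R c \<longleftrightarrow> c \<in> R \<and> (\<forall>d \<in> R. score A w V R c \<le> score A w V R d)"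

text \<open>
  \<open>stv_can_win A w V R p\<close>: starting a round with remaining candidates \<open>R\<close>, there is a way of
  resolving the ties that arise for which \<open>p\<close> wins.
\<close>

inductive stv_can_win ::
  "'a set \<Rightarrow> ('a \<Rightarrow> nat) \<Rightarrow> ('a \<Rightarrow> 'c rel) \<Rightarrow> 'c set \<Rightarrow> 'c \<Rightarrow> bool"
  for A w V where
  win: "round_winner A w V R p \<Longrightarrow> stv_can_win A w V R p"
| eliminate: "\<lbrakk>\<not> (\<exists>c. round_winner A w V R c); may_be_eliminated A w V R c;
     stv_can_win A w V (R - {c}) p\<rbrakk> \<Longrightarrow> stv_can_win A w V R p"

end

theory Submission
  imports Defs
begin

text \<open>
  Complete every vote of the coalition by appending \<open>p\<close>, if it is not ranked yet, and then the
  remaining candidates in any order. As long as \<open>p\<close> remains, the only effect is that votes that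
  would have been ignored now count for \<open>p\<close>. So the scores of the other candidates do not change,
  and in no round do they gain a majority or does \<open>p\<close> lose one. Hence the eliminations of
  the original election can be replayed until \<open>p\<close> wins, possibly in an earlier round.
\<close>

text \<open>The ordinal sum of \<open>r\<close> and the restriction of \<open>q\<close> to the
  unranked candidates, with \<open>r\<close> on top.\<close>

definition append_order :: "'c set \<Rightarrow> 'c rel \<Rightarrow> 'c rel \<Rightarrow> 'c rel" where
  "append_order C r q =
     r \<union> Field r \<times> (C - Field r) \<union> q \<inter> (C - Field r) \<times> (C - Field r)"

lemma linear_order_on_append_order:
  assumes "linear_order_on S r" "S \<subseteq> C" "linear_order_on C q"
  shows "linear_order_on C (append_order C r q)"
proof -
  have S: "Field r = S"
    using assms(1) by (auto simp: order_on_defs refl_on_def Field_def)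
  have sub: "r \<subseteq> S \<times> S" "q \<subseteq> C \<times> C"
    using assms(1,3) by (auto simp: order_on_defs)
  have "refl_on C (append_order C r q)"
    using assms by (auto simp: append_order_def S order_on_defs refl_on_def)
  moreover have "trans (append_order C r q)"
    using assms(1,3) sub unfolding append_order_def S order_on_defs
    by (intro transI) (blast dest: transD)
  moreover have "antisym (append_order C r q)"
    using assms(1,3) sub unfolding append_order_def S order_on_defs
    by (intro antisymI) (blast dest: antisymD)
  moreover have "total_on C (append_order C r q)"
    using assms unfolding append_order_def S order_on_defs total_on_def
    by blast
  moreover have "append_order C r q \<subseteq> C \<times> C"
    using sub assms(2) by (auto simp: append_order_def S)
  ultimately show ?thesis
    by (simp add: order_on_defs)
qed

text \<open>Take the ordinal sum of \<open>{p}\<close> and an arbitrary linear order, which exists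
  by the well-ordering theorem.\<close>

lemma linear_order_on_with_top:
  assumes "p \<in> C"
  obtains q where "linear_order_on C q" "\<And>c. c \<in> C \<Longrightarrow> (p, c) \<in> q"
proof -
  obtain q where "linear_order_on C q"
    using well_order_on well_order_on_def by metis
  moreover have "linear_order_on {p} {(p, p)}"
    by simp
  ultimately have "linear_order_on C (append_order C {(p, p)} q)"
    using assms by (intro linear_order_on_append_order[of "{p}"]) auto
  moreover have "(p, c) \<in> append_order C {(p, p)} q" if "c \<in> C" for c
    using that by (auto simp: append_order_def)
  ultimately show thesis
    by (rule that)
qed

text \<open>The only property of the completed votes that the election argument uses. Sets
  \<open>R\<close> containing \<open>p\<close> suffice, because the eventual winner is never
  eliminated.\<close>

definition fills_in :: "'c \<Rightarrow> 'c rel \<Rightarrow> 'c rel \<Rightarrow> bool" where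
  "fills_in p r s \<longleftrightarrow> (\<forall>R. p \<in> R \<longrightarrow>
     counts_for R s = counts_for R r \<and> ignored R s = ignored R r \<or>
     ignored R r \<and> \<not> ignored R s \<and> counts_for R s = (\<lambda>c. c = p))"

lemma fills_in_refl: "fills_in p r r"
  by (simp add: fills_in_def)

text \<open>While a candidate of \<open>S\<close> remains, it is ranked above all appended ones.
  Once none remains, \<open>p\<close> lies outside \<open>S\<close> and so heads the appended
  part.\<close>

lemma fills_in_append_order:
  assumes "linear_order_on S r" "S \<subseteq> C" "linear_order_on C q"
    and "p \<in> C" "\<And>c. c \<in> C \<Longrightarrow> (p, c) \<in> q"
  shows "fills_in p r (append_order C r q)"
proof -
  let ?s = "append_order C r q"
  have S: "Field r = S"
    using assms(1) by (auto simp: order_on_defs refl_on_def Field_def)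
  have C: "Field ?s = C"
    using linear_order_on_append_order[OF assms(1-3)]
    by (auto simp: order_on_defs refl_on_def Field_def)
  have counts: "counts_for R ?s c \<longleftrightarrow> c \<in> C \<inter> R \<and> (\<forall>d \<in> C \<inter> R. (c, d) \<in> ?s)" for R c
    by (simp add: counts_for_def C)
  have sub: "r \<subseteq> S \<times> S" and anti: "antisym q"
    using assms(1,3) by (auto simp: order_on_defs)
  show ?thesis
    unfolding fills_in_def
  proof (intro allI impI)
    fix R assume p: "p \<in> R"
    then have s: "\<not> ignored R ?s"
      using assms(4) C by (auto simp: ignored_def)
    show "counts_for R ?s = counts_for R r \<and> ignored R ?s = ignored R r \<or>
      ignored R r \<and> \<not> ignored R ?s \<and> counts_for R ?s = (\<lambda>c. c = p)"
    proof (cases "S \<inter> R = {}")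
      case True
      have "counts_for R ?s p"
        unfolding counts using True p assms(4,5) by (auto simp: append_order_def S)
      moreover have "c = p" if "counts_for R ?s c" for c
      proof -
        have "c \<in> C \<inter> R" "(c, p) \<in> ?s"
          using that p assms(4) by (auto simp: counts)
        \<comment> \<open>Neither \<open>c\<close> nor \<open>p\<close> lies in \<open>S\<close>, so
          this pair can only come from \<open>q\<close>.\<close>
        then have "(c, p) \<in> q"
          using True sub p by (auto simp: append_order_def S)
        then show ?thesis
          using anti assms(5) \<open>c \<in> C \<inter> R\<close> by (auto dest: antisymD)
      qed
      ultimately have "counts_for R ?s = (\<lambda>c. c = p)"
        by blast
      then show ?thesis
        using True s by (simp add: ignored_def S)
    next
      case False
      then obtain d where "d \<in> S \<inter> R" by blast
      \<comment> \<open>Every pair of \<open>?s\<close> with second component \<open>d\<close> lies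
        in \<open>r\<close>, so no appended candidate is ranked above \<open>d\<close>.\<close>
      then have "counts_for R ?s c = counts_for R r c" for c
        unfolding counts using sub assms(2) by (auto simp: counts_for_def S append_order_def)
      then show ?thesis
        using False s by (simp add: ignored_def S fun_eq_iff)
    qed
  qed
qed

lemma complete_vote_fills_in:
  assumes "p \<in> C" "complete_vote C r \<or> partial_vote C r"
  shows "\<exists>s. complete_vote C s \<and> fills_in p r s"
proof -
  \<comment> \<open>A complete vote is the case \<open>S = C\<close>, where nothing is
    appended.\<close>
  obtain S where S: "linear_order_on S r" "S \<subseteq> C"
    using assms(2) by (auto simp: complete_vote_def partial_vote_def)
  obtain q where q: "linear_order_on C q" "\<And>c. c \<in> C \<Longrightarrow> (p, c) \<in> q"
    using linear_order_on_with_top[OF assms(1)] by metis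
  show ?thesis
    using linear_order_on_append_order[OF S q(1)] fills_in_append_order[OF S q(1) assms(1) q(2)]
    by (auto simp: complete_vote_def)
qed

lemma ignored_not_counts_for: "ignored R r \<Longrightarrow> \<not> counts_for R r c"
  by (auto simp: ignored_def counts_for_def)

lemma score_fills_in_other:
  assumes "\<forall>i \<in> A. fills_in p (V i) (W i)" "p \<in> R" "c \<noteq> p"
  shows "score A w W R c = score A w V R c"
proof -
  have "counts_for R (W i) c = counts_for R (V i) c" if "i \<in> A" for i
    using assms that ignored_not_counts_for unfolding fills_in_def by metis
  then have "{i \<in> A. counts_for R (W i) c} = {i \<in> A. counts_for R (V i) c}"
    by auto
  then show ?thesis
    by (simp add: score_def)
qed

text \<open>Here \<open>e\<close> is the weight of the votes ignored under \<open>V\<close> but not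
  under \<open>W\<close>. They all count for \<open>p\<close>, so both quantities grow by the same
  amount.\<close>

lemma score_votes_not_ignored_fills_in:
  assumes "finite A" "\<forall>i \<in> A. fills_in p (V i) (W i)" "p \<in> R"
  obtains e where "score A w W R p = score A w V R p + e"
    "votes_not_ignored A w W R = votes_not_ignored A w V R + e"
proof
  let ?E = "{i \<in> A. ignored R (V i) \<and> \<not> ignored R (W i)}"
  have cases: "counts_for R (W i) = counts_for R (V i) \<and> ignored R (W i) = ignored R (V i) \<or>
     ignored R (V i) \<and> \<not> ignored R (W i) \<and> counts_for R (W i) = (\<lambda>c. c = p)" if "i \<in> A" for i
    using assms(2,3) that by (auto simp: fills_in_def)
  have *: "{i \<in> A. counts_for R (W i) p} = {i \<in> A. counts_for R (V i) p} \<union> ?E"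
    using cases ignored_not_counts_for by fastforce
  show "score A w W R p = score A w V R p + sum w ?E"
    unfolding score_def * using assms(1)
    by (intro sum.union_disjoint) (auto dest: ignored_not_counts_for)
  have **: "{i \<in> A. \<not> ignored R (W i)} = {i \<in> A. \<not> ignored R (V i)} \<union> ?E"
    using cases by blast
  show "votes_not_ignored A w W R = votes_not_ignored A w V R + sum w ?E"
    unfolding votes_not_ignored_def ** using assms(1) by (intro sum.union_disjoint) auto
qed

lemma stv_can_win_remaining: "stv_can_win A w V R p \<Longrightarrow> p \<in> R"
  by (induction rule: stv_can_win.induct) (auto simp: round_winner_def)

lemma stv_can_win_fills_in:
  assumes "finite A" "\<forall>i \<in> A. fills_in p (V i) (W i)" "stv_can_win A w V R p"
  shows "stv_can_win A w W R p"
  \<comment> \<open>In \<open>stv_can_win\<close> the winner is an index and not a fixed parameter,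
    so the assumption on \<open>fills_in\<close>, which mentions \<open>p\<close>, has to pass
    through the induction.\<close>
  using assms(3,2)
proof (induction rule: stv_can_win.induct)
  case (win R p)
  then have "p \<in> R"
    by (simp add: round_winner_def)
  then obtain e where "score A w W R p = score A w V R p + e"
    "votes_not_ignored A w W R = votes_not_ignored A w V R + e"
    using score_votes_not_ignored_fills_in[OF assms(1) win(2)] by metis
  \<comment> \<open>A majority of \<open>p\<close> survives: \<open>2 * s > v\<close> implies
    \<open>2 * (s + e) > v + e\<close>.\<close>
  then show ?case
    using win(1) by (intro stv_can_win.win) (auto simp: round_winner_def)
next
  case (eliminate R c p)
  have p: "p \<in> R" "c \<noteq> p"
    using stv_can_win_remaining[OF eliminate(3)] by auto
  obtain e where e: "score A w W R p = score A w V R p + e"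
    "votes_not_ignored A w W R = votes_not_ignored A w V R + e"
    using score_votes_not_ignored_fills_in[OF assms(1) eliminate.prems p(1)] by metis
  note other = score_fills_in_other[OF eliminate.prems p(1)]
  show ?case
  \<comment> \<open>The added votes may already give \<open>p\<close> a majority; then the replay
    stops in this round.\<close>
  proof (cases "round_winner A w W R p")
    case True
    then show ?thesis by (rule stv_can_win.win)
  next
    case False
    have "\<not> round_winner A w W R d" for d
    proof
      assume d: "round_winner A w W R d"
      then have "d \<noteq> p"
        using False by auto
      \<comment> \<open>The score of \<open>d\<close> is the same in both elections and the total
        under \<open>V\<close> is no larger; \<open>R = {d}\<close> is impossible since
        \<open>p \<in> R\<close>.\<close>
      then have "round_winner A w V R d"
        using d p(1) other[of d] e(2) by (auto simp: round_winner_def)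
      then show False
        using eliminate(1) by blast
    qed
    moreover have "may_be_eliminated A w W R c"
      unfolding may_be_eliminated_def
    proof (intro conjI ballI)
      show "c \<in> R"
        using eliminate(2) by (simp add: may_be_eliminated_def)
      fix d assume "d \<in> R"
      then have "score A w V R c \<le> score A w V R d"
        using eliminate(2) by (simp add: may_be_eliminated_def)
      \<comment> \<open>The score of \<open>c\<close> is unchanged as \<open>c\<close> differs from
        \<open>p\<close>, and that of \<open>p\<close> can only have grown.\<close>
      then show "score A w W R c \<le> score A w W R d"
        using other[OF p(2)] other[of d] e(1) by (cases "d = p") auto
    qed
    ultimately show ?thesis
      using eliminate.IH[OF eliminate.prems] stv_can_win.eliminate by metis
  qed
qed

theorem proposition6:
  fixes C :: "'c set" and p :: 'c
    and A K :: "'a set" \<comment> \<open>the agents and the coalition\<close>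
    and w :: "'a \<Rightarrow> nat" and V :: "'a \<Rightarrow> 'c rel"
  assumes "finite C" and "p \<in> C"
    and "finite A" and "K \<subseteq> A"
    and "\<forall>i \<in> A. w i > 0"
    and "\<forall>i \<in> A - K. complete_vote C (V i) \<or> partial_vote C (V i)"
    and "\<exists>X. (\<forall>i \<in> K. complete_vote C (X i) \<or> partial_vote C (X i)) \<and>
           stv_can_win A w (override_on V X K) C p"
  shows "\<exists>Y. (\<forall>i \<in> K. complete_vote C (Y i)) \<and>
           stv_can_win A w (override_on V Y K) C p"
proof -
  obtain X where X: "\<forall>i \<in> K. complete_vote C (X i) \<or> partial_vote C (X i)"
    "stv_can_win A w (override_on V X K) C p"
    using assms(7) by blast
  have "\<forall>i \<in> K. \<exists>s. complete_vote C s \<and> fills_in p (X i) s"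
    using X(1) complete_vote_fills_in[OF assms(2)] by blast
  then obtain Y where Y: "\<forall>i \<in> K. complete_vote C (Y i) \<and> fills_in p (X i) (Y i)"
    by metis
  \<comment> \<open>Outside \<open>K\<close> both elections use the same vote \<open>V i\<close>, so
    reflexivity applies.\<close>
  then have "\<forall>i \<in> A. fills_in p (override_on V X K i) (override_on V Y K i)"
    by (simp add: override_on_def fills_in_refl)
  then have "stv_can_win A w (override_on V Y K) C p"
    using stv_can_win_fills_in[OF assms(3) _ X(2)] by blast
  then show ?thesis
    using Y by blast
qed

end
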